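(* Let $G$ be a connected finite simple graph of order $n$. If $n\geq 3$, then the node reliability polynomial $\mathrm{NRel}(G;p)$ has a nonreal (complex) root.
   Context: For a finite simple undirected graph $G$ with $n$ nodes, a connected set of $G$ is a nonempty subset of nodes inducing a connected subgraph. Let $c_k$ be the number of connected sets of $G$ of order $k$. The node reliability polynomial of $G$ is $\mathrm{NRel}(G;p)=\sum_{k=1}^n c_k p^k(1-p)^{n-k}$ (for $p\in[0,1]$ it is the probability that, when each node independently operates with probability $p$ and edges never fail, the set of operational nodes is nonempty and induces a connected subgraph). It is regarded as a polynomial in a complex variable $p$; its roots are called node reliability roots of $G$. *)

theory Defs
  imports
    Complex_Main
    "HOL-Computational_Algebra.Polynomial"
    "Graph_Theory.Digraph_Component"
begin

text \<open>
  A finite simple undirected graph is a digraph satisfying the locale predicate \<^const>\<open>graph\<close>: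
  finite, loop-free, without parallel arcs, and symmetric, each undirected edge being
  represented by its two opposite arcs. The unqualified name \<open>connected\<close> may also denote
  topological connectedness, so the graph notion is always written in qualified form.
\<close>

definition connected_sets :: "('a, 'b) pre_digraph \<Rightarrow> 'a set set" where
  "connected_sets G =
     {S. S \<subseteq> verts G \<and> S \<noteq> {} \<and> Digraph_Component.connected (G \<restriction> S)}"

definition num_connected_sets :: "('a, 'b) pre_digraph \<Rightarrow> nat \<Rightarrow> nat" where
  "num_connected_sets G k = card {S \<in> connected_sets G. card S = k}"

text \<open>Here \<open>[:0, 1:]\<close> is the indeterminate \<open>p\<close> and \<open>[:1, -1:]\<close> is \<open>1 - p\<close>.\<close>

definition NRel :: "('a, 'b) pre_digraph \<Rightarrow> complex poly" where
  "NRel G = (\<Sum>k = 1..card (verts G).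
     of_nat (num_connected_sets G k) * [:0, 1:] ^ k * [:1, -1:] ^ (card (verts G) - k))"

end

theory Submission
  imports
    Defs
    "HOL-Computational_Algebra.Fundamental_Theorem_Algebra"
    "HOL-Analysis.Complex_Transcendental"
begin

text \<open>
  Since \<open>NRel(p) = (1 - p)\<^sup>n f(p / (1 - p))\<close> with \<open>f(x) = \<Sum>k. c\<^sub>k x\<^sup>k\<close>, real-rootedness of \<open>NRel\<close> would
  make \<open>f(x) / x\<close> real-rooted. Having nonnegative coefficients and constant term \<open>c\<^sub>1 = n\<close>, the monic
  polynomial \<open>f(x) / x\<close> would then be a product of factors \<open>x + r\<^sub>i\<close> for \<open>n - 1\<close> positive reals \<open>r\<^sub>i\<close>
  with product \<open>n\<close> and sum \<open>c\<^sub>n\<^sub>-\<^sub>1 \<le> n\<close>. But \<open>r \<le> exp (r - 1)\<close> gives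
  \<open>n = \<Prod>r\<^sub>i \<le> exp (\<Sum>r\<^sub>i - (n - 1)) \<le> exp 1 < 3\<close>.
\<close>

text \<open>Vieta's formula for the sum of the negated roots. Each new factor adds its constant term
  times the previous leading coefficient, which is 1.\<close>

lemma subleading_coeff_prod_monic_linear:
  fixes a :: "nat \<Rightarrow> 'a :: comm_ring_1"
  shows "coeff (\<Prod>i<Suc n. [:a i, 1:]) n = (\<Sum>i<Suc n. a i)"
proof -
  have degree_le: "degree (\<Prod>i<m. [:a i, 1:]) \<le> m" for m
    using degree_prod_sum_le[of "{..<m}" "\<lambda>i. [:a i, 1:]"] by simp
  have coeff_above: "coeff (\<Prod>i<m. [:a i, 1:]) (Suc m) = 0" for m
    by (rule coeff_eq_0) (use degree_le[of m] in simp)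
  have lead: "coeff (\<Prod>i<m. [:a i, 1:]) m = 1" for m
  proof (induction m)
    case (Suc m)
    then show ?case
      using coeff_above[of m] by simp
  qed simp
  show ?thesis
  proof (induction n)
    case (Suc n)
    have "(\<Prod>i<Suc (Suc n). [:a i, 1:]) = (\<Prod>i<Suc n. [:a i, 1:]) * [:a (Suc n), 1:]"
      by simp
    then have "coeff (\<Prod>i<Suc (Suc n). [:a i, 1:]) (Suc n)
        = a (Suc n) * coeff (\<Prod>i<Suc n. [:a i, 1:]) (Suc n)
          + coeff (\<Prod>i<Suc n. [:a i, 1:]) n"
      by (simp only: mult_pCons_right) simp
    then show ?case
      using Suc.IH lead[of "Suc n"] by simp
  qed simp
qed

text \<open>By Vieta, coefficients \<open>0\<close> and \<open>m\<close> are the product and the sum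
  of the negated roots, which are positive here.\<close>

lemma monic_negative_rooted_coeff_bound:
  fixes q :: "complex poly"
  assumes degree: "degree q = Suc m" and monic: "lead_coeff q = 1"
    and roots: "\<And>z. poly q z = 0 \<Longrightarrow> z \<in> \<real> \<and> Re z < 0"
  shows "Re (coeff q 0) \<le> exp (Re (coeff q m) - real (Suc m))"
proof -
  obtain root where q: "q = (\<Prod>i<Suc m. [:- root i, 1:])"
    using complex_poly_decompose'[of q] degree monic by (metis smult_1_left)
  define r where "r i = - Re (root i)" for i
  have r: "- root i = complex_of_real (r i)" "r i > 0" if "i < Suc m" for i
  proof -
    have "poly q (root i) = 0"
      unfolding q poly_prod using that by (intro prod_zero) auto
    from roots[OF this] show "- root i = complex_of_real (r i)" "r i > 0"
      by (auto simp: r_def complex_is_Real_iff complex_eq_iff)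
  qed
  have q': "q = (\<Prod>i<Suc m. [:complex_of_real (r i), 1:])"
    unfolding q by (intro prod.cong) (auto simp: r(1))
  have "coeff q 0 = (\<Prod>i<Suc m. complex_of_real (r i))"
    unfolding q' by (simp only: poly_0_coeff_0[symmetric] poly_prod) simp
  then have "Re (coeff q 0) = (\<Prod>i<Suc m. r i)"
    by (metis Re_complex_of_real of_real_prod)
  also have "\<dots> \<le> (\<Prod>i<Suc m. exp (r i - 1))"
  proof (intro prod_mono conjI)
    fix i assume "i \<in> {..<Suc m}"
    then show "0 \<le> r i"
      using r(2)[of i] by simp
    show "r i \<le> exp (r i - 1)"
      using exp_ge_add_one_self[of "r i - 1"] by simp
  qed
  also have "\<dots> = exp ((\<Sum>i<Suc m. r i) - real (Suc m))"
    by (simp only: exp_sum[symmetric] finite_lessThan sum_subtractf) simp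
  also have "(\<Sum>i<Suc m. r i) = Re (coeff q m)"
    unfolding q' subleading_coeff_prod_monic_linear by (simp only: of_real_sum[symmetric] Re_complex_of_real)
  finally show ?thesis .
qed

lemma num_connected_sets_1:
  "num_connected_sets G 1 = card (verts G)"
proof -
  \<comment> \<open>The reflexive path suffices. Membership of \<open>v\<close> in
    \<open>verts G\<close> is irrelevant, since \<open>G \<restriction> {v}\<close> has vertex set
    \<open>{v}\<close> by definition.\<close>
  have "Digraph_Component.connected (G \<restriction> {v})" for v
    by (auto simp: Digraph_Component.connected_def mk_symmetric_def strongly_connected_def reachable_def
        intro: rtrancl_on_refl)
  then have "{S \<in> connected_sets G. card S = 1} = (\<lambda>v. {v}) ` verts G"
    by (auto simp: connected_sets_def card_1_singleton_iff)
  then show ?thesis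
    by (simp add: num_connected_sets_def card_image)
qed

lemma num_connected_sets_le_binomial:
  assumes "finite (verts G)"
  shows "num_connected_sets G k \<le> card (verts G) choose k"
proof -
  have "num_connected_sets G k \<le> card {S. S \<subseteq> verts G \<and> card S = k}"
    unfolding num_connected_sets_def using assms
    by (intro card_mono) (auto simp: connected_sets_def)
  with n_subsets[OF assms] show ?thesis
    by simp
qed

text \<open>By finiteness only \<open>verts G\<close> itself has full cardinality, and it induces
  \<open>G\<close> because all arcs have their ends in \<open>verts G\<close>.\<close>

lemma (in fin_digraph) num_connected_sets_card_verts:
  assumes "Digraph_Component.connected G"
  shows "num_connected_sets G (card (verts G)) = 1"
proof -
  have "{e \<in> arcs G. tail G e \<in> verts G \<and> head G e \<in> verts G} = arcs G"
    by auto
  then have "G \<restriction> verts G = G"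
    by (simp add: induce_subgraph_def)
  moreover have "verts G \<noteq> {}"
    using assms by (auto simp: Digraph_Component.connected_def mk_symmetric_def strongly_connected_def)
  ultimately have "{S \<in> connected_sets G. card S = card (verts G)} = {verts G}"
    using assms card_subset_eq[OF finite_verts] by (auto simp: connected_sets_def)
  then show ?thesis
    by (simp add: num_connected_sets_def)
qed

text \<open>Substituting \<open>p = x / (1 + x)\<close> gives \<open>1 - p = 1 / (1 + x)\<close>, so
  every summand acquires the same denominator. The excluded point is the pole of the
  substitution.\<close>

lemma poly_NRel_moebius:
  fixes x :: complex
  assumes "x \<noteq> - 1"
  shows "poly (NRel G) (x / (1 + x)) =
    (\<Sum>k = 1..card (verts G). of_nat (num_connected_sets G k) * x ^ k) / (1 + x) ^ card (verts G)"
proof -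
  have nz: "1 + x \<noteq> 0"
    using assms by (metis add_eq_0_iff)
  have compl: "1 - x / (1 + x) = 1 / (1 + x)"
    using nz by (simp add: field_simps)
  have "(x / (1 + x)) ^ k * (1 / (1 + x)) ^ (n - k) = x ^ k / (1 + x) ^ n" if "k \<le> n" for k n
    using that nz by (simp add: power_divide flip: power_add)
  with compl show ?thesis
    unfolding NRel_def by (simp add: poly_sum sum_divide_distrib mult.assoc flip: times_divide_eq_right)
qed

theorem theorem3:
  fixes G :: "('a, 'b) pre_digraph"
  assumes "graph G"
    and "Digraph_Component.connected G"
    and "card (verts G) \<ge> 3"
  shows "\<exists>z :: complex. poly (NRel G) z = 0 \<and> z \<notin> \<real>"
proof (rule ccontr)
  assume "\<not> ?thesis"
  then have real_rooted: "z \<in> \<real>" if "poly (NRel G) z = 0" for z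
    using that by blast
  interpret graph G by fact
  define n where "n = card (verts G)"
  define c where "c = num_connected_sets G"
  obtain m where n: "n = Suc (Suc m)"
    using assms(3) that[of "n - 2"] by (simp add: n_def)
  have c_1: "c (Suc 0) = n"
    using num_connected_sets_1[of G] by (simp add: c_def n_def)
  have c_n: "c n = 1"
    using num_connected_sets_card_verts assms(2) by (simp add: c_def n_def)
  \<comment> \<open>Here \<open>Suc m\<close> is \<open>n - 1\<close>, and
    \<open>n choose (n - 1) = n\<close>.\<close>
  have c_pred: "c (Suc m) \<le> n"
    using num_connected_sets_le_binomial[of G "Suc m"] unfolding c_def n_def[symmetric] n by simp
  \<comment> \<open>This is \<open>f(x) / x\<close>: the index shift removes the root 0 and makes
    \<open>c 1 = n\<close> the constant coefficient, \<open>c n = 1\<close> the leading one and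
    \<open>c (n - 1)\<close> the one at \<open>m\<close>.\<close>
  define q :: "complex poly" where "q = (\<Sum>k\<le>Suc m. monom (of_nat (c (Suc k))) k)"
  have coeff_q: "coeff q k = (if k \<le> Suc m then of_nat (c (Suc k)) else 0)" for k
    by (simp add: q_def coeff_sum sum.delta)
  have degree_q: "degree q = Suc m"
    by (intro antisym degree_le le_degree) (use c_n n in \<open>auto simp: coeff_q\<close>)
  have poly_q: "poly q x = (\<Sum>k\<le>Suc m. of_nat (c (Suc k)) * x ^ k)" for x
    by (simp add: q_def poly_sum poly_monom)
  have "x \<in> \<real> \<and> Re x < 0" if root: "poly q x = 0" for x
  proof
    show "x \<in> \<real>"
    \<comment> \<open>The pole of the substitution is itself real, so it needs no argument.\<close>
    proof (cases "x = - 1")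
      case False
      have nz: "1 + x \<noteq> 0"
        using False by (metis add_eq_0_iff)
      have "(\<Sum>k = 1..n. of_nat (c k) * x ^ k) = x * poly q x"
        unfolding poly_q n One_nat_def sum.atLeast_Suc_atMost_Suc_shift
        by (simp only: atMost_atLeast0 sum_distrib_left o_def power_Suc mult_ac)
      then have "poly (NRel G) (x / (1 + x)) = 0"
        using poly_NRel_moebius[OF False, of G] root by (simp add: n_def c_def)
      then have "x / (1 + x) \<in> \<real>"
        by (rule real_rooted)
      \<comment> \<open>The inverse map \<open>p / (1 - p)\<close> recovers \<open>x\<close> and
        preserves realness.\<close>
      then have "(x / (1 + x)) / (1 - x / (1 + x)) \<in> \<real>"
        by (blast intro: Reals_divide Reals_diff Reals_1)
      moreover have "(x / (1 + x)) / (1 - x / (1 + x)) = x"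
        using nz by (simp add: field_simps)
      ultimately show ?thesis
        by simp
    qed simp
    then obtain t where t: "x = of_real t"
      by (elim Reals_cases)
    have "complex_of_real (\<Sum>k\<le>Suc m. real (c (Suc k)) * t ^ k) = 0"
      using root unfolding poly_q t by simp
    then have sum_0: "(\<Sum>k\<le>Suc m. real (c (Suc k)) * t ^ k) = 0"
      by (simp only: of_real_eq_0_iff)
    show "Re x < 0"
    proof (rule ccontr)
      assume "\<not> Re x < 0"
      then have "t \<ge> 0"
        by (simp add: t)
      \<comment> \<open>For \<open>t \<ge> 0\<close> no term is negative, so the sum is at least its
        term at \<open>k = 0\<close>, which is \<open>n > 0\<close> even when
        \<open>t = 0\<close>.\<close>
      then have "real (c (Suc 0)) * t ^ 0 \<le> (\<Sum>k\<le>Suc m. real (c (Suc k)) * t ^ k)"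
        by (intro member_le_sum) auto
      then show False
        using sum_0 c_1 n by simp
    qed
  qed
  then have "Re (coeff q 0) \<le> exp (Re (coeff q m) - real (Suc m))"
    by (intro monic_negative_rooted_coeff_bound[OF degree_q]) (use c_n n in \<open>simp_all add: degree_q coeff_q\<close>)
  then have "real n \<le> exp (real (c (Suc m)) - real (Suc m))"
    by (simp add: coeff_q c_1)
  \<comment> \<open>The exponent is at most \<open>n - (n - 1) = 1\<close>.\<close>
  also have "\<dots> \<le> exp 1"
    using c_pred n by simp
  also have "\<dots> < 3"
    using e_less_272 by simp
  finally show False
    using assms(3) by (simp add: n_def)
qed

end
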